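(* For every integer $n\ge 3$, there exists a ucycle of $\mathcal P(n,2)$.
   Context: $[m]=\{1,\dots,m\}$; $\mathcal P(n,2)$ is the set of partitions of $[n]$ into exactly $2$ nonempty parts, and $S(n,2)=|\mathcal P(n,2)|$. A string $r_1\cdots r_n$ over the alphabet $\{1,2\}$ represents $p\in\mathcal P(n,2)$ if $r_i=r_j$ iff $i,j$ lie in the same part of $p$. A ucycle of $\mathcal P(n,2)$ is a cyclic string $a_1\cdots a_N$ over $\{1,2\}$, $N=S(n,2)$, indices modulo $N$, such that each element of $\mathcal P(n,2)$ is represented by exactly one of the windows $a_i a_{i+1}\cdots a_{i+n-1}$, $1\le i\le N$. *)

theory Defs
  imports Main "HOL-Library.Disjoint_Sets"
begin

definition set_partitions :: "nat \<Rightarrow> nat \<Rightarrow> nat set set set" where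
  "set_partitions n k = {p. partition_on {1..n} p \<and> card p = k}"

definition num_set_partitions :: "nat \<Rightarrow> nat \<Rightarrow> nat" where
  "num_set_partitions n k = card (set_partitions n k)"

text \<open>Lists are indexed from 0, so the \<open>i\<close>-th letter of a string \<open>r\<close>, counted from 1,
  is \<open>r ! (i - 1)\<close>.\<close>

definition represents :: "nat \<Rightarrow> nat list \<Rightarrow> nat set set \<Rightarrow> bool" where
  "represents n r p \<longleftrightarrow> length r = n \<and> set r \<subseteq> {1, 2} \<and>
     (\<forall>i\<in>{1..n}. \<forall>j\<in>{1..n}. r ! (i - 1) = r ! (j - 1) \<longleftrightarrow> (\<exists>B\<in>p. i \<in> B \<and> j \<in> B))"

text \<open>The window of length \<open>n\<close> of the cyclic string \<open>a\<close> starting at the 0-based position \<open>i\<close>.\<close>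

definition window :: "nat list \<Rightarrow> nat \<Rightarrow> nat \<Rightarrow> nat list" where
  "window a n i = map (\<lambda>j. a ! ((i + j) mod length a)) [0..<n]"

text \<open>Uniqueness is that of the starting position \<open>i\<close>: windows at different positions
  count as different even if they happen to be the same string.\<close>

definition ucycle :: "nat \<Rightarrow> nat list \<Rightarrow> bool" where
  "ucycle n a \<longleftrightarrow> length a = num_set_partitions n 2 \<and> set a \<subseteq> {1, 2} \<and>
     (\<forall>p\<in>set_partitions n 2. \<exists>!i. i < length a \<and> represents n (window a n i) p)"

end

theory Submission
  imports Defs "Graph_Theory.Euler"
begin

text \<open>
  Replace a string over \<open>{1, 2}\<close> by the string recording where consecutive letters differ. This
  identifies the partitions of \<open>[n]\<close> into two parts with the nonzero binary words of length
  \<open>n - 1\<close>. An Eulerian circuit of the de Bruijn graph without its loop at the zero word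
  yields a cyclic binary string whose windows are exactly these words. Integrating this string
  modulo 2 gives a ucycle; it closes up because exactly \<open>2 ^ (n - 2)\<close> of its letters are 1,
  which is an even number.
\<close>

section \<open>Punctured binary de Bruijn cycles\<close>

text \<open>An arc is the word itself, leading from its first \<open>k\<close> letters to its last
  \<open>k\<close>, so a closed Euler trail lists every nonzero word of length \<open>k + 1\<close>
  exactly once. The excluded zero word would be a loop, so its removal keeps the graph
  balanced.\<close>

definition punctured_de_bruijn :: "nat \<Rightarrow> (bool list, bool list) pre_digraph" where
  "punctured_de_bruijn k = \<lparr>verts = {v. length v = k},
     arcs = {e. length e = Suc k \<and> True \<in> set e}, tail = butlast, head = tl\<rparr>"

lemma punctured_de_bruijn_simps [simp]:
  "verts (punctured_de_bruijn k) = {v. length v = k}"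
  "arcs (punctured_de_bruijn k) = {e. length e = Suc k \<and> True \<in> set e}"
  "tail (punctured_de_bruijn k) = butlast"
  "head (punctured_de_bruijn k) = tl"
  by (simp_all add: punctured_de_bruijn_def)

lemma finite_bool_lists: "finite {v :: bool list. length v = k}"
  using finite_lists_length_eq[of "UNIV :: bool set" k] by simp

lemma card_bool_lists: "card {v :: bool list. length v = k} = 2 ^ k"
  using card_lists_length_eq[of "UNIV :: bool set" k] by simp

lemma fin_digraph_punctured_de_bruijn: "fin_digraph (punctured_de_bruijn k)"
  by unfold_locales (auto intro: finite_subset[OF _ finite_bool_lists])

text \<open>A letter \<open>b\<close> may be put before \<open>v\<close> or after it under the same
  condition: \<open>b\<close> or some letter of \<open>v\<close> must be
  \<open>True\<close>.\<close>

lemma in_degree_eq_out_degree_punctured_de_bruijn: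
  assumes "length v = k"
  shows "in_degree (punctured_de_bruijn k) v = out_degree (punctured_de_bruijn k) v"
proof -
  have "in_arcs (punctured_de_bruijn k) v = (\<lambda>b. b # v) ` {b. b \<or> True \<in> set v}"
  proof (rule set_eqI)
    fix e
    show "e \<in> in_arcs (punctured_de_bruijn k) v \<longleftrightarrow> e \<in> (\<lambda>b. b # v) ` {b. b \<or> True \<in> set v}"
      using assms by (cases e) (auto simp: in_arcs_def)
  qed
  moreover have "out_arcs (punctured_de_bruijn k) v = (\<lambda>b. v @ [b]) ` {b. b \<or> True \<in> set v}"
  proof (rule set_eqI)
    fix e
    show "e \<in> out_arcs (punctured_de_bruijn k) v \<longleftrightarrow> e \<in> (\<lambda>b. v @ [b]) ` {b. b \<or> True \<in> set v}"
      using assms by (cases e rule: rev_cases) (auto simp: out_arcs_def)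
  qed
  ultimately show ?thesis
    by (simp add: in_degree_def out_degree_def card_image inj_on_def)
qed

text \<open>Shifting in \<open>False\<close> repeatedly leads from any vertex to the zero vertex.
  Connectivity concerns the symmetric closure, so no directed walk back has to be built.\<close>

lemma connected_punctured_de_bruijn: "connected (punctured_de_bruijn k)"
proof -
  let ?G = "punctured_de_bruijn k"
  interpret fin_digraph ?G by (rule fin_digraph_punctured_de_bruijn)
  have shift: "v \<rightarrow>\<^sup>*\<^bsub>?G\<^esub> (drop i v @ replicate i False)" if "length v = k" "i \<le> k" for v i
    using that(2)
  proof (induction i)
    case 0
    then show ?case using that by auto
  next
    case (Suc i)
    let ?u = "drop i v @ replicate i False" and ?w = "drop (Suc i) v @ replicate (Suc i) False"
    let ?e = "?u @ [False]"
    have "butlast ?e = ?u"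
      by (rule butlast_snoc)
    moreover have "tl ?e = ?w"
      using Suc.prems that(1) by (simp add: drop_Suc tl_drop replicate_append_same)
    ultimately have e: "length ?e = Suc k" "butlast ?e = ?u" "tl ?e = ?w"
      using Suc.prems that(1) by simp_all
    show ?case
    proof (cases "True \<in> set (drop i v)")
      case True
      then have "?u \<rightarrow>\<^bsub>?G\<^esub> ?w"
        using e by (auto simp: arcs_ends_conv image_iff intro!: exI[of _ ?e])
      then show ?thesis using Suc by (meson Suc_leD reachable_adj_trans)
    next
      \<comment> \<open>Here the arc \<open>?e\<close> would be the missing loop, but the zero
        vertex has already been reached and the shift does not move.\<close>
      case False
      then have "set (drop i v) \<subseteq> {False}" by auto
      then have u: "drop i v = replicate (k - i) False"
        using that(1) by (metis length_drop replicate_eqI singletonD subsetD)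
      then have w: "drop (Suc i) v = replicate (k - Suc i) False"
        by (simp add: drop_Suc tl_drop[symmetric])
      have "?u = ?w"
        using Suc.prems unfolding u w by (simp add: replicate_add[symmetric] del: replicate_Suc)
      then show ?thesis using Suc by simp
    qed
  qed
  have zero: "v \<rightarrow>\<^sup>*\<^bsub>mk_symmetric ?G\<^esub> replicate k False" if "length v = k" for v
    using reachable_mk_symmetricI[OF shift[OF that, of k]] that by simp
  interpret S: wf_digraph "mk_symmetric ?G"
    by (rule wf_digraph_wp_iff[THEN iffD2]) (auto simp: mk_symmetric_def pair_wf_digraph_def)
  show ?thesis
  proof (rule connectedI)
    show "verts ?G \<noteq> {}" by (auto intro: exI[of _ "replicate k False"])
  next
    fix u v assume "u \<in> verts ?G" "v \<in> verts ?G"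
    then show "u \<rightarrow>\<^sup>*\<^bsub>mk_symmetric ?G\<^esub> v"
      using S.reachable_trans[OF zero symmetric_reachable[OF symmetric_mk_symmetric zero]]
      by simp
  qed
qed

lemma (in pre_digraph) cas_nth_Suc:
  assumes "cas u p v" "Suc i < length p"
  shows "tail G (p ! Suc i) = head G (p ! i)"
  using assms
proof (induction p arbitrary: u i)
  case (Cons e p)
  then show ?case by (cases i; cases p) auto
qed simp

lemma (in pre_digraph) closed_cas_nth_Suc_mod:
  assumes "cas u p u" "i < length p"
  shows "tail G (p ! (Suc i mod length p)) = head G (p ! i)"
proof (cases "Suc i < length p")
  case True
  then show ?thesis using assms by (simp add: cas_nth_Suc)
next
  \<comment> \<open>At the wrap-around both sides are the base vertex \<open>u\<close> of the closed
    walk.\<close>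
  case False
  then have "Suc i = length p" using assms(2) by simp
  moreover have "p \<noteq> []" using assms(2) by auto
  moreover have "tail G (hd p) = u" using assms(1) \<open>p \<noteq> []\<close> by (simp add: cas_simp)
  moreover have "head G (last p) = u"
    using assms(1) cas_append_iff[of u "butlast p" "[last p]" u] \<open>p \<noteq> []\<close> by simp
  ultimately show ?thesis by (metis diff_Suc_1 hd_conv_nth last_conv_nth mod_self)
qed

lemma ex_punctured_de_bruijn_cycle:
  obtains d :: "bool list" where
    "length d = 2 ^ Suc k - 1"
    "bij_betw (\<lambda>i. map (\<lambda>j. d ! ((i + j) mod length d)) [0..<Suc k]) {..<length d}
       {e. length e = Suc k \<and> True \<in> set e}"
proof -
  let ?G = "punctured_de_bruijn k" and ?E = "{e. length e = Suc k \<and> True \<in> set e}"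
  interpret fin_digraph ?G by (rule fin_digraph_punctured_de_bruijn)
  obtain u p where "euler_trail u p u"
    using closed_euler1[OF connected_punctured_de_bruijn]
      in_degree_eq_out_degree_punctured_de_bruijn by auto
  then have cas: "cas u p u" and dist: "distinct p" and set_p: "set p = ?E"
    by (auto simp: euler_trail_def trail_def awalk_def)
  \<comment> \<open>Each arc of the Euler circuit contributes its first letter; its other letters
    reappear as the first letters of the arcs that follow.\<close>
  define d where "d = map hd p"
  have len: "length d = length p" by (simp add: d_def)
  have E: "?E = {e. length e = Suc k} - {replicate (Suc k) False}"
    by (auto simp del: replicate_Suc) (metis (full_types) replicate_eqI)
  have "length p = card ?E" using dist set_p distinct_card by metis
  also have "\<dots> = 2 ^ Suc k - 1"
    unfolding E by (subst card_Diff_subset) (simp_all only: card_bool_lists, auto)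
  finally have "length d = 2 ^ Suc k - 1" by (simp add: len)
  moreover
  have nth_p: "length (p ! i) = Suc k" if "i < length p" for i
    using nth_mem[OF that] set_p by auto
  \<comment> \<open>Arc \<open>i\<close> without its first letter is the next arc without its last,
    so letter \<open>j + 1\<close> of one is letter \<open>j\<close> of the other. The induction on
    \<open>j\<close> therefore moves \<open>i\<close> along cyclically.\<close>
  have win: "p ! i ! j = d ! ((i + j) mod length d)" if "i < length p" "j \<le> k" for i j
    using that
  proof (induction j arbitrary: i)
    case 0
    then show ?case using nth_p[of i] by (simp add: d_def hd_conv_nth[symmetric] flip: length_greater_0_conv)
  next
    case (Suc j)
    let ?i = "Suc i mod length p"
    have i: "?i < length p" using Suc.prems by (intro mod_less_divisor) auto
    have "p ! i ! Suc j = tl (p ! i) ! j"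
      using nth_p[of i] Suc.prems by (simp add: nth_tl)
    also have "\<dots> = butlast (p ! ?i) ! j"
      using closed_cas_nth_Suc_mod[OF cas Suc.prems(1)] by simp
    also have "\<dots> = p ! ?i ! j"
      using nth_p[OF i] Suc.prems by (simp add: nth_butlast)
    also have "\<dots> = d ! ((?i + j) mod length d)"
      using Suc.IH[OF i] Suc.prems by simp
    also have "(?i + j) mod length d = (i + Suc j) mod length d"
      by (simp add: len mod_simps)
    finally show ?case .
  qed
  have "bij_betw ((!) p) {..<length d} ?E"
    using bij_betw_nth[OF dist] set_p len by auto
  then have "bij_betw (\<lambda>i. map (\<lambda>j. d ! ((i + j) mod length d)) [0..<Suc k]) {..<length d} ?E"
    by (rule bij_betw_cong[THEN iffD1, rotated])
      (auto intro!: nth_equalityI simp: len nth_p win simp del: upt_Suc)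
  ultimately show thesis by (rule that)
qed

section \<open>Partitions into two parts\<close>

lemma set_partitions_2_iff:
  "p \<in> set_partitions n 2 \<longleftrightarrow>
     (\<exists>B. B \<noteq> {} \<and> B \<subset> {1..n} \<and> p = {B, {1..n} - B})"
proof
  assume "p \<in> set_partitions n 2"
  then have "partition_on {1..n} p" "card p = 2" by (auto simp: set_partitions_def)
  from this(2) obtain B C where p: "p = {B, C}" "B \<noteq> C" by (auto simp: card_2_iff)
  with \<open>partition_on {1..n} p\<close> have "B \<noteq> {}" "C \<noteq> {}" "B \<union> C = {1..n}" "B \<inter> C = {}"
    by (auto simp: partition_on_def disjoint_def)
  then have "C = {1..n} - B" "B \<subset> {1..n}" by auto
  then show "\<exists>B. B \<noteq> {} \<and> B \<subset> {1..n} \<and> p = {B, {1..n} - B}"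
    using p \<open>B \<noteq> {}\<close> by blast
next
  assume "\<exists>B. B \<noteq> {} \<and> B \<subset> {1..n} \<and> p = {B, {1..n} - B}"
  then obtain B where B: "B \<noteq> {}" "B \<subset> {1..n}" "p = {B, {1..n} - B}" by blast
  then have "B \<noteq> {1..n} - B" by blast
  with B show "p \<in> set_partitions n 2"
    by (auto simp: set_partitions_def partition_on_def disjoint_def)
qed

text \<open>A partition is determined by its part that misses 1, which can be any nonempty subset of
  \<open>{2..n}\<close>.\<close>

lemma num_set_partitions_2:
  assumes "n \<ge> 1"
  shows "num_set_partitions n 2 = 2 ^ (n - 1) - 1"
proof -
  let ?f = "\<lambda>B. {B, {1..n} - B}"
  have "bij_betw ?f (Pow {2..n} - {{}}) (set_partitions n 2)"
    unfolding bij_betw_def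
  proof
    have "1 \<in> {1..n} - B" if "B \<subseteq> {2..n}" for B using that assms by auto
    then show "inj_on ?f (Pow {2..n} - {{}})"
      by (intro inj_onI) (smt (verit) DiffD1 DiffD2 PowD doubleton_eq_iff)
    show "?f ` (Pow {2..n} - {{}}) = set_partitions n 2"
    proof (intro equalityI subsetI)
      fix p assume "p \<in> ?f ` (Pow {2..n} - {{}})"
      then obtain B where B: "B \<subseteq> {2..n}" "B \<noteq> {}" "p = ?f B" by auto
      moreover have "B \<subset> {1..n}"
      proof
        show "B \<subseteq> {1..n}" using B(1) by fastforce
        show "B \<noteq> {1..n}" using B(1) assms by auto
      qed
      ultimately show "p \<in> set_partitions n 2" unfolding set_partitions_2_iff by blast
    next
      fix p assume "p \<in> set_partitions n 2"
      then obtain B where B: "B \<noteq> {}" "B \<subset> {1..n}" "p = ?f B"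
        unfolding set_partitions_2_iff by blast
      have *: "C \<subseteq> {2..n}" if "C \<subseteq> {1..n}" "1 \<notin> C" for C
        using that by (fastforce simp: numeral_2_eq_2 Suc_le_eq intro: le_neq_implies_less)
      show "p \<in> ?f ` (Pow {2..n} - {{}})"
      proof (cases "1 \<in> B")
        case True
        have "{1..n} - B \<noteq> {}" using B by blast
        moreover have "p = ?f ({1..n} - B)" using B by (simp add: double_diff insert_commute psubset_imp_subset)
        ultimately show ?thesis using *[of "{1..n} - B"] True by blast
      next
        case False
        then show ?thesis using B *[of B] by blast
      qed
    qed
  qed
  then have "num_set_partitions n 2 = card (Pow {2..n} - {{}})"
    unfolding num_set_partitions_def by (rule bij_betw_same_card[symmetric])
  also have "\<dots> = 2 ^ (n - 1) - 1"
    by (simp add: card_Pow)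
  finally show ?thesis .
qed

text \<open>This is where two letters matter: two Booleans are equal iff they compare alike with a
  third, here the value at 0. With three letters, adjacent comparisons would not determine the
  others.\<close>

lemma eq_iff_eq_of_adjacent:
  fixes f g :: "nat \<Rightarrow> bool"
  assumes "\<And>j. Suc j < n \<Longrightarrow> (f j = f (Suc j)) = (g j = g (Suc j))" "i < n" "j < n"
  shows "(f i = f j) = (g i = g j)"
proof -
  have "(f j = f 0) = (g j = g 0)" if "j < n" for j
    using that
  proof (induction j)
    case (Suc j)
    then show ?case using assms(1)[of j] by auto
  qed simp
  from this[of i] this[of j] assms(2,3) show ?thesis by auto
qed

text \<open>The difference modulo 2 of the indicator of \<open>B\<close> along 1, ...,
  \<open>n\<close>. Complementing \<open>B\<close> in \<open>{1..n}\<close> leaves it unchanged, so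
  it belongs to the partition and not to the chosen part.\<close>

definition changes :: "nat \<Rightarrow> nat set \<Rightarrow> bool list" where
  "changes n B = map (\<lambda>j. (Suc j \<in> B) \<noteq> (Suc (Suc j) \<in> B)) [0..<n - 1]"

lemma changes_has_True:
  assumes "B \<noteq> {}" "B \<subset> {1..n}"
  shows "True \<in> set (changes n B)"
proof (rule ccontr)
  assume "True \<notin> set (changes n B)"
  then have *: "(Suc j \<in> B) = (Suc (Suc j) \<in> B)" if "Suc j < n" for j
    using that by (auto simp: changes_def)
  have "(Suc i \<in> B) = (Suc j \<in> B)" if "i < n" "j < n" for i j
    \<comment> \<open>Comparison with a constant function: without changes the indicator of
      \<open>B\<close> is constant on \<open>{1..n}\<close>.\<close>
    using eq_iff_eq_of_adjacent[of n "\<lambda>i. Suc i \<in> B" "\<lambda>_. True" i j] * that by auto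
  moreover obtain x y where "x \<in> B" "x \<in> {1..n}" "y \<in> {1..n}" "y \<notin> B" using assms by blast
  ultimately show False
    by (metis Suc_le_eq Suc_pred atLeastAtMost_iff One_nat_def)
qed

lemma represents_iff_changes:
  assumes "B \<subseteq> {1..n}" "length r = n" "set r \<subseteq> {1, 2}"
  shows "represents n r {B, {1..n} - B} \<longleftrightarrow>
    map (\<lambda>j. r ! j \<noteq> r ! Suc j) [0..<n - 1] = changes n B"
proof -
  \<comment> \<open>Over the alphabet \<open>{1, 2}\<close> a letter is encoded by the Boolean
    \<open>r ! i = 1\<close>, to which the adjacency lemma applies.\<close>
  have r: "(r ! i = r ! j) = ((r ! i = 1) = (r ! j = 1))" if "i < n" "j < n" for i j
    using assms that by (metis insert_iff nth_mem singletonD subsetD)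
  have "represents n r {B, {1..n} - B} \<longleftrightarrow>
      (\<forall>i\<in>{1..n}. \<forall>j\<in>{1..n}. (r ! (i - 1) = r ! (j - 1)) = ((i \<in> B) = (j \<in> B)))"
    using assms unfolding represents_def by auto
  also have "\<dots> \<longleftrightarrow> (\<forall>i<n. \<forall>j<n. (r ! i = r ! j) = ((Suc i \<in> B) = (Suc j \<in> B)))"
    unfolding image_Suc_lessThan[symmetric] by auto
  also have "\<dots> \<longleftrightarrow> (\<forall>j. Suc j < n \<longrightarrow> (r ! j = r ! Suc j) = ((Suc j \<in> B) = (Suc (Suc j) \<in> B)))"
    (is "_ \<longleftrightarrow> ?adj")
  proof
    assume ?adj
    then show "\<forall>i<n. \<forall>j<n. (r ! i = r ! j) = ((Suc i \<in> B) = (Suc j \<in> B))"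
      using eq_iff_eq_of_adjacent[of n "\<lambda>i. r ! i = 1" "\<lambda>i. Suc i \<in> B"] r by simp
  qed (use Suc_lessD in blast)
  also have "\<dots> \<longleftrightarrow> map (\<lambda>j. r ! j \<noteq> r ! Suc j) [0..<n - 1] = changes n B"
    unfolding changes_def by auto
  finally show ?thesis .
qed

section \<open>Integrating a de Bruijn cycle\<close>

text \<open>The window at \<open>i\<close> begins with \<open>d ! i\<close>, so the positions of
  \<open>True\<close> correspond to the words beginning with \<open>True\<close>. These are all
  nonzero, and their remaining \<open>k\<close> letters are free.\<close>

lemma card_True_punctured_de_bruijn_cycle:
  assumes "bij_betw (\<lambda>i. map (\<lambda>j. d ! ((i + j) mod length d)) [0..<Suc k]) {..<length d}
       {e. length e = Suc k \<and> True \<in> set e}"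
  shows "card {i. i < length d \<and> d ! i} = 2 ^ k"
proof -
  let ?w = "\<lambda>i. map (\<lambda>j. d ! ((i + j) mod length d)) [0..<Suc k]"
  have hd: "hd (?w i) = d ! i" if "i < length d" for i
    using that by (simp add: hd_map del: upt_Suc)
  have "?w ` {i. i < length d \<and> d ! i} = {e \<in> ?w ` {..<length d}. hd e}"
    using hd by (auto simp del: upt_Suc)
  also have "\<dots> = {e. length e = Suc k \<and> True \<in> set e \<and> hd e}"
    using assms by (auto simp: bij_betw_def simp del: upt_Suc)
  also have "\<dots> = Cons True ` {v. length v = k}"
    by (auto simp: length_Suc_conv image_iff)
  finally have "card (?w ` {i. i < length d \<and> d ! i}) = 2 ^ k"
    by (simp add: card_image card_bool_lists del: upt_Suc)
  moreover have "inj_on ?w {i. i < length d \<and> d ! i}"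
    using assms unfolding bij_betw_def by (rule inj_on_subset[OF conjunct1]) auto
  ultimately show ?thesis by (simp only: card_image)
qed

lemma ex_cyclic_integral:
  fixes d :: "bool list"
  assumes "d \<noteq> []" "even (card {i. i < length d \<and> d ! i})"
  obtains a :: "nat list" where "length a = length d" "set a \<subseteq> {1, 2}"
    "\<And>i. (a ! (i mod length a) \<noteq> a ! (Suc i mod length a)) = d ! (i mod length d)"
proof -
  \<comment> \<open>The discrete integral of \<open>d\<close>; its parity selects the letter of
    \<open>a\<close>.\<close>
  define c where "c i = card {j. j < i \<and> d ! j}" for i
  define a :: "nat list" where "a = map (\<lambda>i. if even (c i) then 1 else 2) [0..<length d]"
  have c_Suc: "c (Suc i) = c i + (if d ! i then 1 else 0)" for i
  proof -
    have "{j. j < Suc i \<and> d ! j} = (if d ! i then insert i {j. j < i \<and> d ! j} else {j. j < i \<and> d ! j})"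
      by (auto simp: less_Suc_eq)
    then show ?thesis by (simp add: c_def)
  qed
  have "length a = length d" "set a \<subseteq> {1, 2}" by (auto simp: a_def)
  moreover have "(a ! (i mod length a) \<noteq> a ! (Suc i mod length a)) = d ! (i mod length d)" for i
  proof -
    define l where "l = i mod length d"
    have l: "l < length d" using assms(1) by (simp add: l_def)
    have "Suc i mod length d = Suc l mod length d" by (simp add: l_def mod_Suc_eq)
    \<comment> \<open>Only the wrap-around needs an argument: \<open>c 0\<close> is 0, and
      \<open>c (length d)\<close> is even by assumption.\<close>
    moreover have "even (c (Suc l mod length d)) = even (c (Suc l))"
      using assms(2) l by (cases "Suc l = length d") (auto simp: c_def)
    moreover have "Suc l mod length d < length d" using assms(1) by simp
    ultimately show ?thesis
      using l c_Suc[of l] by (auto simp: a_def l_def[symmetric])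
  qed
  ultimately show thesis by (rule that)
qed

theorem corollary13:
  fixes n :: nat
  assumes "n \<ge> 3"
  shows "\<exists>a. ucycle n a"
proof -
  define k where "k = n - 2"
  have n: "n = Suc (Suc k)" "n - 1 = Suc k" "k \<noteq> 0" using assms by (auto simp: k_def)
  obtain d :: "bool list" where len: "length d = 2 ^ Suc k - 1" and
    d: "bij_betw (\<lambda>i. map (\<lambda>j. d ! ((i + j) mod length d)) [0..<Suc k]) {..<length d}
       {e. length e = Suc k \<and> True \<in> set e}"
    by (rule ex_punctured_de_bruijn_cycle)
  have "(1::nat) < 2 ^ Suc k" by (rule one_less_power) auto
  then have "d \<noteq> []" using len by (intro notI) (simp del: power_Suc)
  \<comment> \<open>The hypothesis on \<open>n\<close> enters here: the number of
    \<open>True\<close> letters is \<open>2 ^ k\<close>, which is even because \<open>k\<close> is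
    nonzero.\<close>
  have "even (card {i. i < length d \<and> d ! i})"
    using card_True_punctured_de_bruijn_cycle[OF d] n(3) by simp
  with \<open>d \<noteq> []\<close> obtain a :: "nat list" where a: "length a = length d" "set a \<subseteq> {1, 2}"
    "\<And>i. (a ! (i mod length a) \<noteq> a ! (Suc i mod length a)) = d ! (i mod length d)"
    by (rule ex_cyclic_integral) blast
  have "\<exists>!i. i < length a \<and> represents n (window a n i) p" if p: "p \<in> set_partitions n 2" for p
  proof -
    obtain B where B: "B \<noteq> {}" "B \<subset> {1..n}" "p = {B, {1..n} - B}"
      using p unfolding set_partitions_2_iff by blast
    \<comment> \<open>The differences inside a window of \<open>a\<close> form the window of
      \<open>d\<close> at the same position, one letter shorter. So the bijection \<open>d\<close>
      yields exactly one suitable \<open>i\<close>.\<close>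
    have "represents n (window a n i) p \<longleftrightarrow>
        map (\<lambda>j. d ! ((i + j) mod length d)) [0..<Suc k] = changes n B" for i
    proof -
      have "set (window a n i) \<subseteq> set a"
        using a(1) \<open>d \<noteq> []\<close> by (auto simp: window_def intro!: nth_mem)
      with a(2) have "set (window a n i) \<subseteq> {1, 2}" by (rule subset_trans[rotated])
      then have "represents n (window a n i) p \<longleftrightarrow>
          map (\<lambda>j. window a n i ! j \<noteq> window a n i ! Suc j) [0..<n - 1] = changes n B"
        unfolding B(3) by (intro represents_iff_changes) (use B in \<open>auto simp: window_def\<close>)
      also have "map (\<lambda>j. window a n i ! j \<noteq> window a n i ! Suc j) [0..<n - 1] =
          map (\<lambda>j. d ! ((i + j) mod length d)) [0..<Suc k]"
        unfolding n(2) using a(3)[of "i + j" for j]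
        by (intro map_cong) (auto simp: window_def n(1) simp del: upt_Suc)
      finally show ?thesis .
    qed
    moreover have "changes n B \<in> {e. length e = Suc k \<and> True \<in> set e}"
      using changes_has_True[OF B(1,2)] n(2) by (simp add: changes_def del: upt_Suc)
    ultimately show ?thesis
      using d[THEN bij_betwE] bij_betw_imp_inj_on[OF d] bij_betw_imp_surj_on[OF d] a(1)
      by (simp only: inj_on_def) (smt (verit) imageE lessThan_iff)
  qed
  moreover have "length a = num_set_partitions n 2"
    using num_set_partitions_2[of n] len a(1) n by simp
  ultimately show ?thesis using a(2) unfolding ucycle_def by blast
qed

end
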